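(* Let $\mathcal{A}$ be a complex unital Banach algebra, let $a\in\mathcal{A}$, and let $p(z)=z^d+\alpha_1z^{d-1}+\cdots+\alpha_d$ be a monic polynomial with complex coefficients. Let $V_p(a)=\{z\in\mathbb{C}:|p(z)|\le\|p(a)\|\}$, and for $z\in\mathbb{C}$ put $$Q_j(z)=z^j+\alpha_1z^{j-1}+\cdots+\alpha_j\quad(j=0,1,\dots,d-1),\qquad q(z,a)=\sum_{j=0}^{d-1}Q_{d-1-j}(z)\,a^j .$$ If $z\notin V_p(a)$, then $$(z-a)^{-1}=\frac{q(z,a)}{p(z)}\sum_{j=0}^\infty\frac{p(a)^j}{p(z)^j}.$$
   Context: The unit $e$ of $\mathcal{A}$ satisfies $\|e\|=1$; $z-a$ means $ze-a$ and $a^0=p(a)^0=e$. *)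

theory Defs
  imports "HOL-Analysis.Analysis" "HOL-Computational_Algebra.Polynomial"
begin

text \<open>
  Complex unital Banach algebras. The library only has real normed algebras; the underlying real
  structure, completeness, submultiplicativity of the norm and \<open>norm 1 = 1\<close> are inherited from
  \<open>real_normed_algebra_1\<close> and \<open>banach\<close>, and a compatible complex scalar multiplication is added.
\<close>

class complex_banach_algebra_1 = real_normed_algebra_1 + banach +
  fixes scaleC :: "complex \<Rightarrow> 'a \<Rightarrow> 'a"  (infixr "*\<^sub>C" 75)
  assumes scaleC_add_right: "c *\<^sub>C (x + y) = c *\<^sub>C x + c *\<^sub>C y"
    and scaleC_add_left: "(c + c') *\<^sub>C x = c *\<^sub>C x + c' *\<^sub>C x"
    and scaleC_scaleC: "c *\<^sub>C (c' *\<^sub>C x) = (c * c') *\<^sub>C x"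
    and scaleC_one: "1 *\<^sub>C x = x"
    and mult_scaleC_left: "(c *\<^sub>C x) * y = c *\<^sub>C (x * y)"
    and mult_scaleC_right: "x * (c *\<^sub>C y) = c *\<^sub>C (x * y)"
    and norm_scaleC: "norm (c *\<^sub>C x) = cmod c * norm x"
    and scaleR_scaleC: "r *\<^sub>R x = complex_of_real r *\<^sub>C x"

instantiation complex :: complex_banach_algebra_1
begin

definition scaleC_complex :: "complex \<Rightarrow> complex \<Rightarrow> complex"
  where "scaleC_complex c x = c * x"

instance
  by standard
    (simp_all add: scaleC_complex_def algebra_simps norm_mult scaleR_conv_of_real)

end

text \<open>Two-sided inverses; \<open>alg_inv x\<close> is meaningful only if \<open>alg_invertible x\<close>.\<close>

definition alg_invertible :: "'a::monoid_mult \<Rightarrow> bool"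
  where "alg_invertible x \<longleftrightarrow> (\<exists>y. x * y = 1 \<and> y * x = 1)"

definition alg_inv :: "'a::monoid_mult \<Rightarrow> 'a"
  where "alg_inv x = (THE y. x * y = 1 \<and> y * x = 1)"

definition alg_poly :: "complex poly \<Rightarrow> 'a::complex_banach_algebra_1 \<Rightarrow> 'a"
  where "alg_poly p a = (\<Sum>i\<le>degree p. coeff p i *\<^sub>C a ^ i)"

text \<open>
  The coefficients are indexed by codegree: \<open>\<alpha> k\<close> belongs to \<open>z ^ (d - k)\<close> for \<open>1 \<le> k \<le> d\<close>, the
  leading coefficient is \<open>1\<close>, and the values of \<open>\<alpha>\<close> outside \<open>{1..d}\<close> are irrelevant.
\<close>

definition monic_poly :: "nat \<Rightarrow> (nat \<Rightarrow> complex) \<Rightarrow> complex poly"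
  where "monic_poly d \<alpha> = monom 1 d + (\<Sum>k=1..d. monom (\<alpha> k) (d - k))"

definition V_set :: "complex poly \<Rightarrow> 'a::complex_banach_algebra_1 \<Rightarrow> complex set"
  where "V_set p a = {z. cmod (poly p z) \<le> norm (alg_poly p a)}"

definition Q_fun :: "(nat \<Rightarrow> complex) \<Rightarrow> nat \<Rightarrow> complex \<Rightarrow> complex"
  where "Q_fun \<alpha> j z = z ^ j + (\<Sum>k=1..j. \<alpha> k * z ^ (j - k))"

definition q_fun :: "nat \<Rightarrow> (nat \<Rightarrow> complex) \<Rightarrow> complex \<Rightarrow> 'a::complex_banach_algebra_1 \<Rightarrow> 'a"
  where "q_fun d \<alpha> z a = (\<Sum>j<d. Q_fun \<alpha> (d - 1 - j) z *\<^sub>C a ^ j)"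

end

theory Submission
  imports Defs
begin

text \<open>
  Since \<open>Q\<^sub>j\<^sub>+\<^sub>1(z) = z Q\<^sub>j(z) + \<alpha>\<^sub>j\<^sub>+\<^sub>1\<close>, Horner's scheme yields
  \<open>(z - a) q(z,a) = q(z,a) (z - a) = p(z) - p(a)\<close>. For \<open>z \<notin> V\<^sub>p(a)\<close> the element
  \<open>1 - p(a)/p(z)\<close> is inverted by its Neumann series \<open>S\<close>, so with \<open>r = q(z,a)/p(z)\<close> the product
  \<open>r S\<close> is a right inverse and \<open>S r\<close> a left inverse of \<open>z - a\<close>; hence the two coincide.
\<close>

lemma scaleC_zero_left [simp]: "0 *\<^sub>C x = (0::'a::complex_banach_algebra_1)"
  using scaleC_add_left[of 0 0 x] by simp

lemma scaleC_diff_right: "c *\<^sub>C (x - y) = c *\<^sub>C x - c *\<^sub>C (y::'a::complex_banach_algebra_1)"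
  using scaleC_add_right[of c "x - y" y] by (simp add: algebra_simps)

lemma power_scaleC: "(c *\<^sub>C x) ^ n = c ^ n *\<^sub>C (x::'a::complex_banach_algebra_1) ^ n"
  by (induction n)
    (simp_all add: scaleC_one mult_scaleC_left mult_scaleC_right scaleC_scaleC mult.commute)

lemma alg_poly_pCons:
  "alg_poly (pCons c p) a = c *\<^sub>C 1 + alg_poly p a * (a::'a::complex_banach_algebra_1)"
\<comment> \<open>\<open>alg_poly\<close> sums up to the degree, and \<open>pCons\<close> raises the
  degree by one only when \<open>p\<close> is nonzero.\<close>
proof (cases "p = 0")
  case True
  then show ?thesis by (simp add: alg_poly_def)
next
  case False
  then show ?thesis
    by (simp add: alg_poly_def sum.atMost_Suc_shift sum_distrib_right mult_scaleC_left
        power_Suc2 del: power_Suc sum.atMost_Suc)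
qed

text \<open>Indexing by codegree makes this a Horner step: with \<alpha> fixed, the old coefficients
  move up one power and \<open>\<alpha> (Suc d)\<close> becomes the constant term. This is what
  permits induction on \<open>d\<close>.\<close>

lemma monic_poly_Suc: "monic_poly (Suc d) \<alpha> = pCons (\<alpha> (Suc d)) (monic_poly d \<alpha>)"
proof -
  have "(\<Sum>k=1..d. monom (\<alpha> k) (Suc d - k)) = (\<Sum>k=1..d. monom 1 1 * monom (\<alpha> k) (d - k))"
    by (rule sum.cong) (auto simp: mult_monom Suc_diff_le)
  also have "\<dots> = monom 1 1 * (\<Sum>k=1..d. monom (\<alpha> k) (d - k))"
    by (rule sum_distrib_left[symmetric])
  finally show ?thesis
    by (simp add: monic_poly_def monom_Suc monom_0)
qed

lemma poly_monic_poly: "poly (monic_poly d \<alpha>) z = Q_fun \<alpha> d z"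
  by (simp add: monic_poly_def Q_fun_def poly_monom poly_sum)

lemma Q_fun_Suc: "Q_fun \<alpha> (Suc d) z = \<alpha> (Suc d) + z * Q_fun \<alpha> d z"
  by (simp add: monic_poly_Suc flip: poly_monic_poly)

text \<open>The summand for \<open>j = 0\<close> is split off; in the others
  \<open>d - Suc j = d - 1 - j\<close>, so the shifted sum is the previous \<open>q_fun\<close>
  times \<open>a\<close>.\<close>

lemma q_fun_Suc:
  "q_fun (Suc d) \<alpha> z a = Q_fun \<alpha> d z *\<^sub>C 1 + q_fun d \<alpha> z a * (a::'a::complex_banach_algebra_1)"
  by (simp add: q_fun_def sum.lessThan_Suc_shift sum_distrib_right mult_scaleC_left power_Suc2
      del: power_Suc sum.lessThan_Suc)

lemma q_fun_commutes: "a * q_fun d \<alpha> z a = q_fun d \<alpha> z a * (a::'a::complex_banach_algebra_1)"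
  by (simp add: q_fun_def sum_distrib_left sum_distrib_right mult_scaleC_left mult_scaleC_right
      power_commutes)

lemma q_fun_factorization:
  fixes a :: "'a::complex_banach_algebra_1"
  shows "(z *\<^sub>C 1 - a) * q_fun d \<alpha> z a
    = poly (monic_poly d \<alpha>) z *\<^sub>C 1 - alg_poly (monic_poly d \<alpha>) a"
proof (induction d)
  case 0
  show ?case by (simp add: q_fun_def monic_poly_def alg_poly_def)
next
  case (Suc d)
  let ?p = "monic_poly d \<alpha>" and ?u = "z *\<^sub>C 1 - a"
  let ?w = "poly ?p z"
  \<comment> \<open>The head coefficient \<open>Q_fun \<alpha> d z\<close> is \<open>?w\<close>, and
    \<open>a\<close> stands on the right, so the induction hypothesis applies to the
    bracket.\<close>
  have "?u * q_fun (Suc d) \<alpha> z a = ?w *\<^sub>C ?u + (?u * q_fun d \<alpha> z a) * a"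
    by (simp add: q_fun_Suc poly_monic_poly ring_distribs(1) mult_scaleC_right mult.assoc)
  also have "\<dots> = ?w *\<^sub>C ?u + (?w *\<^sub>C 1 - alg_poly ?p a) * a"
    by (simp only: Suc.IH)
  \<comment> \<open>The two terms \<open>?w *\<^sub>C a\<close> cancel.\<close>
  also have "\<dots> = (z * ?w) *\<^sub>C 1 - alg_poly ?p a * a"
    by (simp add: scaleC_diff_right scaleC_scaleC mult_scaleC_left left_diff_distrib mult.commute)
  also have "\<dots> = poly (monic_poly (Suc d) \<alpha>) z *\<^sub>C 1 - alg_poly (monic_poly (Suc d) \<alpha>) a"
    by (simp add: monic_poly_Suc alg_poly_pCons scaleC_add_left)
  finally show ?case .
qed

text \<open>Multiplying the convergent series by \<open>x\<close> on either side shifts it by one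
  index, so the difference telescopes to \<open>x ^ 0 = 1\<close>.\<close>

lemma neumann_series:
  fixes x :: "'a::{real_normed_algebra_1, banach}"
  assumes "norm x < 1"
  shows "(1 - x) * (\<Sum>n. x ^ n) = 1" and "(\<Sum>n. x ^ n) * (1 - x) = 1"
proof -
  note sm = complete_algebra_summable_geometric[OF assms]
  have split: "(\<Sum>n. x ^ n) - (\<Sum>n. x ^ Suc n) = 1"
    using suminf_split_head[OF sm] by simp
  show "(1 - x) * (\<Sum>n. x ^ n) = 1"
    using split suminf_mult[OF sm, of x] by (simp add: left_diff_distrib)
  show "(\<Sum>n. x ^ n) * (1 - x) = 1"
    using split suminf_mult2[OF sm, of x] by (simp add: right_diff_distrib power_commutes)
qed

text \<open>Any left inverse \<open>y\<close> satisfies \<open>y = y * (u * r) = r\<close>. This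
  makes \<open>r\<close> two-sided and also gives the uniqueness behind \<open>THE\<close>.\<close>

lemma inverse_if_left_right_inverse:
  fixes u :: "'a::monoid_mult"
  assumes "u * r = 1" "l * u = 1"
  shows "alg_invertible u" "alg_inv u = r"
proof -
  have left_unique: "y = r" if "y * u = 1" for y
    using assms(1) that by (metis mult.assoc mult_1_left mult_1_right)
  then have "r * u = 1"
    using assms(2) by blast
  then show "alg_invertible u" "alg_inv u = r"
    using assms(1) left_unique unfolding alg_invertible_def alg_inv_def by blast+
qed

theorem proposition9p1:
  fixes a :: "'a::complex_banach_algebra_1"
    and d :: nat and \<alpha> :: "nat \<Rightarrow> complex" and p :: "complex poly" and z :: complex
  assumes "p = monic_poly d \<alpha>"
    and "z \<notin> V_set p a"
  shows "summable (\<lambda>j. (1 / poly p z ^ j) *\<^sub>C alg_poly p a ^ j)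
    \<and> alg_invertible (z *\<^sub>C 1 - a)
    \<and> alg_inv (z *\<^sub>C 1 - a) =
        ((1 / poly p z) *\<^sub>C q_fun d \<alpha> z a) * (\<Sum>j. (1 / poly p z ^ j) *\<^sub>C alg_poly p a ^ j)"
proof -
  define w where "w = poly p z"
  define x where "x = (1 / w) *\<^sub>C alg_poly p a"
  define r where "r = (1 / w) *\<^sub>C q_fun d \<alpha> z a"
  define S where "S = (\<Sum>j. x ^ j)"
  let ?u = "z *\<^sub>C 1 - a"
  \<comment> \<open>Strictness yields both \<open>w \<noteq> 0\<close> and
    \<open>norm x < 1\<close>.\<close>
  have less: "norm (alg_poly p a) < cmod w"
    using assms(2) by (simp add: V_set_def w_def)
  then have "w \<noteq> 0"
    by auto
  have "norm x < 1"
    using less by (simp add: x_def norm_scaleC norm_divide divide_simps)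
  have terms: "(1 / w ^ j) *\<^sub>C alg_poly p a ^ j = x ^ j" for j
    by (simp add: x_def power_scaleC power_one_over)
  have "?u * r = (1 / w) *\<^sub>C (w *\<^sub>C 1 - alg_poly p a)"
    unfolding r_def w_def assms(1) by (simp only: mult_scaleC_right q_fun_factorization)
  also have "\<dots> = 1 - x"
    using \<open>w \<noteq> 0\<close> by (simp add: scaleC_diff_right scaleC_scaleC scaleC_one x_def)
  finally have ur: "?u * r = 1 - x" .
  \<comment> \<open>\<open>r\<close> is a polynomial in \<open>a\<close>, hence commutes with
    \<open>z *\<^sub>C 1 - a\<close>.\<close>
  have "r * ?u = ?u * r"
    by (simp add: r_def left_diff_distrib right_diff_distrib mult_scaleC_left mult_scaleC_right
        q_fun_commutes scaleC_diff_right scaleC_scaleC mult.commute)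
  then have ru: "r * ?u = 1 - x"
    using ur by simp
  have "?u * (r * S) = 1" "(S * r) * ?u = 1"
    using neumann_series[OF \<open>norm x < 1\<close>] by (simp_all add: S_def ur ru mult.assoc flip: mult.assoc[of ?u r])
  from inverse_if_left_right_inverse[OF this] show ?thesis
    using complete_algebra_summable_geometric[OF \<open>norm x < 1\<close>]
    by (simp add: terms r_def S_def flip: w_def)
qed

end
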